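(* Let $n\ge 0$ be an integer. The following map is a bijection from the set of Barrucand $n$-deals to the set of $2\times n$ abelian matrices over $\{1,2,3\}$. Given a Barrucand $n$-deal, for each denomination $d\in\{1,\dots,n\}$ the $d$-th column $\left(\begin{smallmatrix}p\\ q\end{smallmatrix}\right)$ of the matrix (top entry $p$, bottom entry $q$) is: - $\left(\begin{smallmatrix}1\\1\end{smallmatrix}\right)$ if $d$ is not in the deal; - $\left(\begin{smallmatrix}1\\2\end{smallmatrix}\right)$ if $d$ is in the deal, does not occur in red's hand, and the red card of denomination $d$ is not in blue's hand; - $\left(\begin{smallmatrix}1\\3\end{smallmatrix}\right)$ if $d$ does not occur in red's hand but the red card of denomination $d$ is in blue's hand; - $\left(\begin{smallmatrix}2\\1\end{smallmatrix}\right)$, $\left(\begin{smallmatrix}2\\2\end{smallmatrix}\right)$, $\left(\begin{smallmatrix}2\\3\end{smallmatrix}\right)$ if the red card of denomination $d$ is in blue's hand and $d$ occurs in red's hand on both the green and blue cards, on the green card only, on the blue card only, respectively; - $\left(\begin{smallmatrix}3\\1\end{smallmatrix}\right)$, $\left(\begin{smallmatrix}3\\2\end{smallmatrix}\right)$, $\left(\begin{smallmatrix}3\\3\end{smallmatrix}\right)$ if the red card of denomination $d$ is not in blue's hand and $d$ occurs in red's hand on both the green and blue cards, on the green card only, on the blue card only, respectively. Its inverse sends an abelian matrix to the deal in which, writing $pq$ for the set of positions $d$ at which the column is $\left(\begin{smallmatrix}p\\ q\end{smallmatrix}\right)$: - red's hand contains both the green and blue cards of the denominations in $21\cup 31$,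 only the green cards of those in $22\cup 32$, and only the blue cards of those in $23\cup 33$; - green's hand contains both the blue and red cards of the denominations in $12\cup 32$, only the blue cards of those in $13\cup 22$, and only the red cards of those in $31\cup 33$; - blue's hand contains both the red and green cards of the denominations in $13\cup 23$, only the red cards of those in $21\cup 22$, and only the green cards of those in $12\cup 33$.
   Context: A Barrucand $n$-deal is formed as follows. Start with a deck of $3n$ cards, $n$ each colored red, green and blue, with one card of each color in each denomination $1,\dots,n$. Choose an arbitrary subset of the denominations (the denominations "in the deal") and deal all cards of the chosen denominations into three equal-size hands to three players designated red, green and blue, in such a way that no player receives a card of her own color. A deal is determined by the set of cards in each hand. A $2\times n$ abelian matrix over $\{1,2,3\}$ is a $2\times n$ matrix with entries in $\{1,2,3\}$ whose bottom row is a rearrangement of its top row. *)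

theory Defs
  imports "Jordan_Normal_Form.Matrix" "HOL-Combinatorics.Permutations"
    "HOL-Library.Disjoint_Sets"
begin

text \<open>The three colours also name the three players.\<close>

datatype color = Red | Green | Blue

type_synonym card = "nat \<times> color"

text \<open>A deal is given by the hand of each player; the denominations in the deal are
  recovered from the hands.\<close>

type_synonym deal = "color \<Rightarrow> card set"

definition barrucand_deals :: "nat \<Rightarrow> deal set" where
  "barrucand_deals n = {H. \<exists>D \<subseteq> {1..n}.
     (\<Union>x. H x) = D \<times> UNIV \<and> disjoint_family H \<and>
     (\<forall>x y. card (H x) = card (H y)) \<and>
     (\<forall>x d. (d, x) \<notin> H x)}"

definition denominations :: "deal \<Rightarrow> nat set" where
  "denominations H = fst ` (\<Union>x. H x)"

definition held :: "deal \<Rightarrow> color \<Rightarrow> nat \<Rightarrow> color set" where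
  "held H x d = {c. (d, c) \<in> H x}"

definition abelian_matrices :: "nat \<Rightarrow> nat mat set" where
  "abelian_matrices n = {M \<in> carrier_mat 2 n. elements_mat M \<subseteq> {1, 2, 3} \<and>
     (\<exists>\<pi>. \<pi> permutes {..<n} \<and> (\<forall>j<n. M $$ (1, j) = M $$ (0, \<pi> j)))}"

inductive column :: "deal \<Rightarrow> nat \<Rightarrow> nat \<times> nat \<Rightarrow> bool" for H :: deal and d :: nat where
  "d \<notin> denominations H \<Longrightarrow> column H d (1, 1)"
| "d \<in> denominations H \<Longrightarrow> held H Red d = {} \<Longrightarrow> (d, Red) \<notin> H Blue \<Longrightarrow> column H d (1, 2)"
| "held H Red d = {} \<Longrightarrow> (d, Red) \<in> H Blue \<Longrightarrow> column H d (1, 3)"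
| "(d, Red) \<in> H Blue \<Longrightarrow> held H Red d = {Green, Blue} \<Longrightarrow> column H d (2, 1)"
| "(d, Red) \<in> H Blue \<Longrightarrow> held H Red d = {Green} \<Longrightarrow> column H d (2, 2)"
| "(d, Red) \<in> H Blue \<Longrightarrow> held H Red d = {Blue} \<Longrightarrow> column H d (2, 3)"
| "(d, Red) \<notin> H Blue \<Longrightarrow> held H Red d = {Green, Blue} \<Longrightarrow> column H d (3, 1)"
| "(d, Red) \<notin> H Blue \<Longrightarrow> held H Red d = {Green} \<Longrightarrow> column H d (3, 2)"
| "(d, Red) \<notin> H Blue \<Longrightarrow> held H Red d = {Blue} \<Longrightarrow> column H d (3, 3)"

text \<open>Matrix indices start at 0, so denomination \<open>d\<close> belongs to column index \<open>d - 1\<close>.\<close>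

definition deal_to_matrix :: "nat \<Rightarrow> deal \<Rightarrow> nat mat" where
  "deal_to_matrix n H = mat 2 n (\<lambda>(i, j).
     let c = (THE c. column H (Suc j) c) in if i = 0 then fst c else snd c)"

definition positions :: "nat \<Rightarrow> nat mat \<Rightarrow> nat \<Rightarrow> nat \<Rightarrow> nat set" where
  "positions n M p q = {d \<in> {1..n}. M $$ (0, d - 1) = p \<and> M $$ (1, d - 1) = q}"

fun matrix_to_deal :: "nat \<Rightarrow> nat mat \<Rightarrow> deal" where
  "matrix_to_deal n M Red =
     (positions n M 2 1 \<union> positions n M 3 1) \<times> {Green, Blue} \<union>
     (positions n M 2 2 \<union> positions n M 3 2) \<times> {Green} \<union>
     (positions n M 2 3 \<union> positions n M 3 3) \<times> {Blue}"
| "matrix_to_deal n M Green =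
     (positions n M 1 2 \<union> positions n M 3 2) \<times> {Blue, Red} \<union>
     (positions n M 1 3 \<union> positions n M 2 2) \<times> {Blue} \<union>
     (positions n M 3 1 \<union> positions n M 3 3) \<times> {Red}"
| "matrix_to_deal n M Blue =
     (positions n M 1 3 \<union> positions n M 2 3) \<times> {Red, Green} \<union>
     (positions n M 2 1 \<union> positions n M 2 2) \<times> {Red} \<union>
     (positions n M 1 2 \<union> positions n M 3 3) \<times> {Green}"

end

theory Submission
  imports Defs
begin

text \<open>
  In a denomination that is in the deal, the hands amount to a function sending the colour of each
  card to the player who holds it. The rule that no player receives her own colour makes this
  function free of fixed points, and nothing else is required of it, so there are two choices for
  each of three colours: eight functions, as many as the columns other than \<open>(1, 1)\<close>. The function
  \<open>holder\<close> makes this correspondence explicit, and \<open>column_iff\<close> shows that it is the one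
  that the nine rules of \<open>column\<close> describe. Denomination by denomination, this gives a bijection
  between all matrices over \<open>{1, 2, 3}\<close> and all deals with hands of arbitrary sizes.

  It remains to see that equal hands correspond to abelian matrices. Number the players 1, 2, 3
  in the order red, green, blue. A check of the nine columns shows that a column \<open>(p, q)\<close> other than
  \<open>(1, 1)\<close> gives player \<open>i\<close> exactly \<open>1 + [q = i] - [p = i]\<close> cards (\<open>card_share\<close>). Summed over
  the columns, the size of the hand of player \<open>i\<close> is the number of denominations in the deal,
  plus the number of \<open>i\<close> in the bottom row, minus the number of \<open>i\<close> in the top row. The three
  differences sum to zero, so the hands have equal size exactly when each difference vanishes, that
  is, when the rows are rearrangements of each other.
\<close>

section \<open>Columns and holders of cards\<close>

lemma UNIV_color: "UNIV = {Red, Green, Blue}"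
  by (auto intro: color.exhaust)

instance color :: finite
  by standard (simp add: UNIV_color)

lemma all_color: "(\<forall>c. P c) \<longleftrightarrow> P Red \<and> P Green \<and> P Blue"
  by (metis color.exhaust)

lemma Collect_color:
  "{c. P c} = (if P Red then {Red} else {}) \<union> (if P Green then {Green} else {}) \<union>
     (if P Blue then {Blue} else {})"
  by (simp add: set_eq_iff all_color)

text \<open>The player who holds the card of the given colour in a denomination whose column is the given
  one; meaningful for the columns over \<open>{1, 2, 3}\<close> other than \<open>(1, 1)\<close>.\<close>

fun holder :: "nat \<times> nat \<Rightarrow> color \<Rightarrow> color" where
  "holder (p, q) Red = (if p = 2 \<or> p = 1 \<and> q = 3 then Blue else Green)"
| "holder (p, q) Green = (if p \<noteq> 1 \<and> q \<noteq> 3 then Red else Blue)"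
| "holder (p, q) Blue = (if p \<noteq> 1 \<and> q \<noteq> 2 then Red else Green)"

definition share :: "nat \<times> nat \<Rightarrow> color \<Rightarrow> color set" where
  "share pq x = (if pq = (1, 1) then {} else {c. holder pq c = x})"

lemma holder_neq: "holder pq c \<noteq> c"
  by (cases pq; cases c) auto

abbreviation symbols :: "nat set" where
  "symbols \<equiv> {1, 2, 3}"

lemma holder_inj:
  assumes "pq \<in> symbols \<times> symbols - {(1, 1)}" "pq' \<in> symbols \<times> symbols - {(1, 1)}"
    and "holder pq = holder pq'"
  shows "pq = pq'"
proof -
  have "\<forall>c. holder pq c = holder pq' c"
    using assms(3) by simp
  then show ?thesis
    using assms(1,2) by (auto simp: all_color split: if_splits)
qed

lemma holder_surj:
  assumes "\<And>c. f c \<noteq> c"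
  obtains pq where "pq \<in> symbols \<times> symbols - {(1, 1)}" "holder pq = f"
proof -
  have cases: "f Red = Green \<or> f Red = Blue" "f Green = Red \<or> f Green = Blue"
      "f Blue = Red \<or> f Blue = Green"
    using assms by (metis color.exhaust)+
  define p where "p = (if f Green \<noteq> Red \<and> f Blue \<noteq> Red then 1 else if f Red = Blue then 2 else 3 :: nat)"
  define q where "q = (if p = 1 then if f Red = Green then 2 else 3
      else if f Green \<noteq> Red then 3 else if f Blue \<noteq> Red then 2 else 1 :: nat)"
  have "holder (p, q) c = f c" for c
    using cases by (cases c; elim disjE) (simp_all add: p_def q_def)
  moreover have "(p, q) \<in> symbols \<times> symbols - {(1, 1)}"
    by (simp add: p_def q_def)
  ultimately show ?thesis
    using that by blast
qed

fun player_number :: "color \<Rightarrow> nat" where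
  "player_number Red = 1"
| "player_number Green = 2"
| "player_number Blue = 3"

text \<open>This is what ties the sizes of the hands to the contents of the two rows. The column
  \<open>(1, 1)\<close> fits the pattern except for the leading 1.\<close>

lemma card_share:
  assumes "p \<in> symbols" "q \<in> symbols"
  shows "int (card (share (p, q) x)) =
    of_bool ((p, q) \<noteq> (1, 1)) + of_bool (q = player_number x) - of_bool (p = player_number x)"
proof -
  show ?thesis
    using assms by (cases x) (auto simp: share_def Collect_color)
qed

section \<open>Deals with hands of arbitrary sizes\<close>

definition layouts :: "nat \<Rightarrow> deal set" where
  "layouts n = {H. \<exists>D \<subseteq> {1..n}. (\<Union>x. H x) = D \<times> UNIV \<and> disjoint_family H \<and>
     (\<forall>x d. (d, x) \<notin> H x)}"

lemma barrucand_deals_eq: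
  "barrucand_deals n = {H \<in> layouts n. \<forall>x y. card (H x) = card (H y)}"
  unfolding barrucand_deals_def layouts_def by blast

lemma denominations_layout:
  assumes "H \<in> layouts n"
  shows "denominations H \<subseteq> {1..n}" "(\<Union>x. H x) = denominations H \<times> UNIV"
proof -
  obtain D where D: "D \<subseteq> {1..n}" "(\<Union>x. H x) = D \<times> UNIV"
    using assms by (auto simp: layouts_def)
  have "denominations H = D"
    unfolding denominations_def D(2) by force
  with D show "denominations H \<subseteq> {1..n}" "(\<Union>x. H x) = denominations H \<times> UNIV"
    by auto
qed

lemma layout_holder:
  assumes H: "H \<in> layouts n" and d: "d \<in> denominations H"
  obtains f where "\<And>c. f c \<noteq> c" "\<And>c x. (d, c) \<in> H x \<longleftrightarrow> f c = x"
proof -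
  have "\<forall>c. \<exists>x. (d, c) \<in> H x"
    using denominations_layout(2)[OF H] d by blast
  then obtain f where f: "\<And>c. (d, c) \<in> H (f c)"
    by metis
  have disj: "disjoint_family H" and own: "\<And>x. (d, x) \<notin> H x"
    using H by (auto simp: layouts_def)
  have "(d, c) \<in> H x \<longleftrightarrow> f c = x" for c x
    using f[of c] disj by (auto simp: disjoint_family_on_def)
  moreover have "f c \<noteq> c" for c
    using f own by metis
  ultimately show ?thesis
    using that by blast
qed

text \<open>The nine rules of \<open>column\<close> look only at the red card and at the hand of red. In a deal, these
  determine the rest: what red does not hold of the green and blue cards goes to the one player
  who may still receive it.\<close>

lemma column_iff:
  assumes H: "H \<in> layouts n"
  shows "column H d pq \<longleftrightarrow> pq \<in> symbols \<times> symbols \<and> (\<forall>x. held H x d = share pq x)"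
proof (cases "d \<in> denominations H")
  case False
  then have none: "(d, c) \<notin> H x" for c x
    by (force simp: denominations_def)
  then have empty: "held H x d = {}" for x
    by (simp add: held_def)
  have "column H d pq \<longleftrightarrow> pq = (1, 1)"
    using False none empty by (auto simp: column.simps)
  moreover have "share pq (holder pq Red) \<noteq> {}" if "pq \<noteq> (1, 1)"
    using that by (auto simp: share_def)
  ultimately show ?thesis
    using empty by (auto simp: share_def)
next
  case True
  obtain f where f: "\<And>c. f c \<noteq> c" "\<And>c x. (d, c) \<in> H x \<longleftrightarrow> f c = x"
    using layout_holder[OF H True] by blast
  have held: "held H x d = {c. f c = x}" for x
    using f(2) by (simp add: held_def)
  have set_eq: "{c. P c} = A \<longleftrightarrow>
      (P Red \<longleftrightarrow> Red \<in> A) \<and> (P Green \<longleftrightarrow> Green \<in> A) \<and> (P Blue \<longleftrightarrow> Blue \<in> A)" for P A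
    by (simp add: set_eq_iff all_color)
  have cases: "f Red = Green \<or> f Red = Blue" "f Green = Red \<or> f Green = Blue"
      "f Blue = Red \<or> f Blue = Green"
    using f(1) by (metis color.exhaust)+
  have "(\<forall>x. held H x d = share pq x) \<longleftrightarrow> pq \<noteq> (1, 1) \<and> (\<forall>c. holder pq c = f c)"
    unfolding held share_def by auto
  moreover have "column H d pq \<longleftrightarrow>
      pq \<in> symbols \<times> symbols \<and> pq \<noteq> (1, 1) \<and> (\<forall>c. holder pq c = f c)"
    using cases True unfolding column.simps held set_eq f(2) all_color
    by (elim disjE) (cases pq; simp; fail | cases pq; auto; fail)+
  ultimately show ?thesis
    by blast
qed

lemma column_exists:
  assumes H: "H \<in> layouts n"
  shows "\<exists>pq. column H d pq"
proof (cases "d \<in> denominations H")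
  case False
  then show ?thesis
    by (blast intro: column.intros)
next
  case True
  obtain f where f: "\<And>c. f c \<noteq> c" "\<And>c x. (d, c) \<in> H x \<longleftrightarrow> f c = x"
    using layout_holder[OF H True] by blast
  obtain pq where "pq \<in> symbols \<times> symbols - {(1, 1)}" "holder pq = f"
    using holder_surj f(1) by blast
  then have "column H d pq"
    using f(2) by (auto simp: column_iff[OF H] share_def held_def)
  then show ?thesis ..
qed

lemma share_inj:
  assumes "pq \<in> symbols \<times> symbols" "pq' \<in> symbols \<times> symbols"
    and "\<And>x. share pq x = share pq' x"
  shows "pq = pq'"
proof (cases "pq = (1, 1) \<or> pq' = (1, 1)")
  case True
  have "share r (holder r Red) \<noteq> {}" if "r \<noteq> (1, 1)" for r
    using that by (auto simp: share_def)
  then show ?thesis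
    using True assms(3) by (metis share_def)
next
  case False
  then have "holder pq = holder pq'"
    using assms(3) by (fastforce simp: share_def)
  then show ?thesis
    using holder_inj assms(1,2) False by blast
qed

lemma column_unique_ex:
  assumes "H \<in> layouts n"
  shows "\<exists>!pq. column H d pq"
proof (rule ex_ex1I[OF column_exists[OF assms]])
  fix pq pq'
  assume "column H d pq" "column H d pq'"
  then show "pq = pq'"
    unfolding column_iff[OF assms] by (intro share_inj) simp_all
qed

section \<open>The bijection with arbitrary matrices\<close>

definition symbol_matrices :: "nat \<Rightarrow> nat mat set" where
  "symbol_matrices n = {M \<in> carrier_mat 2 n. elements_mat M \<subseteq> symbols}"

definition col_pair :: "nat mat \<Rightarrow> nat \<Rightarrow> nat \<times> nat" where
  "col_pair M d = (M $$ (0, d - 1), M $$ (1, d - 1))"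

lemma col_pair_symbols:
  assumes "M \<in> symbol_matrices n" "d \<in> {1..n}"
  shows "col_pair M d \<in> symbols \<times> symbols"
proof -
  have entry: "M $$ (i, d - 1) \<in> symbols" if "i < 2" for i
    using assms that elements_matI[of M 2 n i "d - 1"] by (fastforce simp: symbol_matrices_def)
  show ?thesis
    unfolding col_pair_def by (intro SigmaI entry) simp_all
qed

lemma symbol_matrix_eqI:
  assumes "M \<in> carrier_mat 2 n" "N \<in> carrier_mat 2 n"
    and "\<And>d. d \<in> {1..n} \<Longrightarrow> col_pair M d = col_pair N d"
  shows "M = N"
proof (rule eq_matI)
  fix i j assume ij: "i < dim_row N" "j < dim_col N"
  have "col_pair M (Suc j) = col_pair N (Suc j)"
    using ij assms by auto
  then show "M $$ (i, j) = N $$ (i, j)"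
    using ij assms(2) by (auto simp: col_pair_def less_2_cases_iff)
qed (use assms in auto)

lemma matrix_to_deal_iff:
  assumes M: "M \<in> symbol_matrices n"
  shows "(d, c) \<in> matrix_to_deal n M x \<longleftrightarrow> d \<in> {1..n} \<and> c \<in> share (col_pair M d) x"
proof (cases "d \<in> {1..n}")
  case False
  then show ?thesis
    by (cases x) (auto simp: positions_def)
next
  case True
  define p q where pq: "p = M $$ (0, d - 1)" "q = M $$ (1, d - 1)"
  have sym: "p \<in> symbols" "q \<in> symbols"
    using col_pair_symbols[OF M True] pq by (auto simp: col_pair_def)
  have pos: "d \<in> positions n M p' q' \<longleftrightarrow> p = p' \<and> q = q'" for p' q'
    using True pq by (auto simp: positions_def)
  have cp: "col_pair M d = (p, q)"
    by (simp add: col_pair_def pq)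
  show ?thesis
    using sym True by (cases x; cases c) (auto simp: pos cp share_def)
qed

lemma held_matrix_to_deal:
  assumes "M \<in> symbol_matrices n" "d \<in> {1..n}"
  shows "held (matrix_to_deal n M) x d = share (col_pair M d) x"
  using assms by (auto simp: held_def matrix_to_deal_iff)

lemma denominations_matrix_to_deal:
  assumes "M \<in> symbol_matrices n"
  shows "(\<Union>x. matrix_to_deal n M x) = {d \<in> {1..n}. col_pair M d \<noteq> (1, 1)} \<times> UNIV"
  by (auto simp: matrix_to_deal_iff[OF assms] share_def split: if_splits)

lemma matrix_to_deal_layout:
  assumes "M \<in> symbol_matrices n"
  shows "matrix_to_deal n M \<in> layouts n"
proof -
  have "disjoint_family (matrix_to_deal n M)"
    by (auto simp: disjoint_family_on_def matrix_to_deal_iff[OF assms] share_def split: if_splits)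
  moreover have "(d, x) \<notin> matrix_to_deal n M x" for d x
    by (simp add: matrix_to_deal_iff[OF assms] share_def holder_neq)
  ultimately show ?thesis
    unfolding layouts_def mem_Collect_eq
    by (intro exI[of _ "{d \<in> {1..n}. col_pair M d \<noteq> (1, 1)}"] conjI
        denominations_matrix_to_deal[OF assms]) auto
qed

lemma column_deal_to_matrix:
  assumes "H \<in> layouts n" "d \<in> {1..n}"
  shows "column H d (col_pair (deal_to_matrix n H) d)"
proof -
  have "col_pair (deal_to_matrix n H) d = (THE pq. column H d pq)"
    using assms(2) by (auto simp: col_pair_def deal_to_matrix_def Let_def)
  then show ?thesis
    using theI'[OF column_unique_ex[OF assms(1), of d]] by simp
qed

lemma deal_to_matrix_symbols:
  assumes "H \<in> layouts n"
  shows "deal_to_matrix n H \<in> symbol_matrices n"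
proof -
  have "deal_to_matrix n H $$ (i, j) \<in> symbols" if "i < 2" "j < n" for i j
  proof -
    have "col_pair (deal_to_matrix n H) (Suc j) \<in> symbols \<times> symbols"
      using column_deal_to_matrix[OF assms, of "Suc j"] that column_iff[OF assms] by auto
    then show ?thesis
      using that(1) by (auto simp: col_pair_def less_2_cases_iff)
  qed
  moreover have "deal_to_matrix n H \<in> carrier_mat 2 n"
    by (simp add: deal_to_matrix_def)
  ultimately show ?thesis
    unfolding symbol_matrices_def by (fastforce dest!: elements_matD simp del: insert_iff)
qed

lemma matrix_to_deal_to_matrix:
  assumes M: "M \<in> symbol_matrices n"
  shows "deal_to_matrix n (matrix_to_deal n M) = M"
proof (rule symbol_matrix_eqI)
  note layout = matrix_to_deal_layout[OF M]
  fix d assume d: "d \<in> {1..n}"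
  have "column (matrix_to_deal n M) d (col_pair M d)"
    using col_pair_symbols[OF M d] held_matrix_to_deal[OF M d] by (simp add: column_iff[OF layout])
  then show "col_pair (deal_to_matrix n (matrix_to_deal n M)) d = col_pair M d"
    using column_deal_to_matrix[OF layout d] column_unique_ex[OF layout] by blast
qed (use M deal_to_matrix_symbols matrix_to_deal_layout in \<open>auto simp: symbol_matrices_def\<close>)

lemma deal_to_matrix_to_deal:
  assumes H: "H \<in> layouts n"
  shows "matrix_to_deal n (deal_to_matrix n H) = H"
proof -
  note M = deal_to_matrix_symbols[OF H]
  have "(d, c) \<in> matrix_to_deal n (deal_to_matrix n H) x \<longleftrightarrow> (d, c) \<in> H x" for d c x
  proof (cases "d \<in> {1..n}")
    case True
    then have "held H x d = share (col_pair (deal_to_matrix n H) d) x"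
      using column_deal_to_matrix[OF H] column_iff[OF H] by blast
    then show ?thesis
      using True by (auto simp: matrix_to_deal_iff[OF M] held_def)
  next
    case False
    then have "(d, c) \<notin> H x"
      using denominations_layout[OF H] by blast
    then show ?thesis
      using False by (simp only: matrix_to_deal_iff[OF M] simp_thms)
  qed
  then show ?thesis
    by (intro ext) auto
qed

section \<open>Equal hands and abelian matrices\<close>

lemma card_hand:
  assumes M: "M \<in> symbol_matrices n"
  shows "int (card (matrix_to_deal n M x)) =
    int (card {d \<in> {1..n}. col_pair M d \<noteq> (1, 1)})
    + int (card {j. j < n \<and> M $$ (1, j) = player_number x})
    - int (card {j. j < n \<and> M $$ (0, j) = player_number x})"
proof -
  have card_of_bool: "(\<Sum>d \<in> {1..n}. of_bool (P d)) = int (card {d \<in> {1..n}. P d})" for P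
    by (simp add: Int_def)
  have shift: "card {d \<in> {1..n}. P (d - 1)} = card {j. j < n \<and> P j}" for P
    by (rule bij_betw_same_card, rule bij_betwI[where f = "\<lambda>d. d - 1" and g = Suc]) auto
  have "matrix_to_deal n M x = (SIGMA d : {1..n}. share (col_pair M d) x)"
    by (auto simp: matrix_to_deal_iff[OF M])
  then have "int (card (matrix_to_deal n M x)) =
      (\<Sum>d \<in> {1..n}. int (card (share (col_pair M d) x)))"
    by simp
  also have "\<dots> = (\<Sum>d \<in> {1..n}. of_bool (col_pair M d \<noteq> (1, 1))
      + of_bool (M $$ (1, d - 1) = player_number x) - of_bool (M $$ (0, d - 1) = player_number x))"
  proof (intro sum.cong refl)
    fix d assume "d \<in> {1..n}"
    from col_pair_symbols[OF M this]
    show "int (card (share (col_pair M d) x)) = of_bool (col_pair M d \<noteq> (1, 1))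
        + of_bool (M $$ (1, d - 1) = player_number x) - of_bool (M $$ (0, d - 1) = player_number x)"
      unfolding col_pair_def mem_Sigma_iff using card_share by blast
  qed
  also have "\<dots> = int (card {d \<in> {1..n}. col_pair M d \<noteq> (1, 1)})
      + int (card {d \<in> {1..n}. M $$ (1, d - 1) = player_number x})
      - int (card {d \<in> {1..n}. M $$ (0, d - 1) = player_number x})"
    by (simp only: sum.distrib sum_subtractf card_of_bool)
  also have "card {d \<in> {1..n}. M $$ (1, d - 1) = player_number x} =
      card {j. j < n \<and> M $$ (1, j) = player_number x}"
    by (rule shift)
  also have "card {d \<in> {1..n}. M $$ (0, d - 1) = player_number x} =
      card {j. j < n \<and> M $$ (0, j) = player_number x}"
    by (rule shift)
  finally show ?thesis .
qed

lemma rearrangement_iff_counts: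
  fixes f g :: "nat \<Rightarrow> 'a"
  shows "(\<exists>\<pi>. \<pi> permutes {..<n} \<and> (\<forall>j<n. g j = f (\<pi> j))) \<longleftrightarrow>
   (\<forall>v. card {j. j < n \<and> g j = v} = card {j. j < n \<and> f j = v})"
proof -
  have count: "count (image_mset h (mset_set {..<n})) v = card {j. j < n \<and> h j = v}" for h v
    by (simp add: count_image_mset_eq_card_vimage)
  have "(\<forall>v. card {j. j < n \<and> g j = v} = card {j. j < n \<and> f j = v}) \<longleftrightarrow>
      image_mset g (mset_set {..<n}) = image_mset f (mset_set {..<n})"
    by (simp add: multiset_eq_iff count)
  also have "\<dots> \<longleftrightarrow> (\<exists>\<pi>. \<pi> permutes {..<n} \<and> (\<forall>j<n. g j = f (\<pi> j)))"
    using image_mset_eq_implies_permutes[of "{..<n}" g f]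
      permutes_implies_image_mset_eq[of _ "{..<n}" g f]
    by (metis finite_lessThan lessThan_iff)
  finally show ?thesis
    by blast
qed

lemma sum_symbol_counts:
  fixes f :: "nat \<Rightarrow> nat"
  assumes "\<And>j. j < n \<Longrightarrow> f j \<in> symbols"
  shows "card {j. j < n \<and> f j = 1} + card {j. j < n \<and> f j = 2} + card {j. j < n \<and> f j = 3} = n"
proof -
  have "(\<Sum>v \<in> symbols. card {j \<in> {..<n}. f j = v}) = card {..<n}"
    using assms unfolding card_eq_sum by (intro sum.group) auto
  then show ?thesis
    by simp
qed

text \<open>Equal hands make the difference between the rows in the count of \<open>i\<close> the same for all three
  players \<open>i\<close>; since both rows have length \<open>n\<close>, this common difference is zero.\<close>

lemma matrix_to_deal_barrucand_iff:
  assumes M: "M \<in> symbol_matrices n"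
  shows "matrix_to_deal n M \<in> barrucand_deals n \<longleftrightarrow> M \<in> abelian_matrices n"
proof -
  define count where "count i v = card {j. j < n \<and> M $$ (i, j) = v}" for i v
  have symbols: "M $$ (0, j) \<in> symbols" "M $$ (1, j) \<in> symbols" if "j < n" for j
    using col_pair_symbols[OF M, of "Suc j"] that by (auto simp: col_pair_def)
  have zero: "count 0 v = 0" "count 1 v = 0" if "v \<notin> symbols" for v
    using symbols that unfolding count_def by (metis (mono_tags, lifting) card.empty empty_Collect_eq)+
  have total: "count 0 1 + count 0 2 + count 0 3 = count 1 1 + count 1 2 + count 1 3"
    using sum_symbol_counts[of n "\<lambda>j. M $$ (0, j)"] sum_symbol_counts[of n "\<lambda>j. M $$ (1, j)"] symbols
    unfolding count_def by simp
  have "matrix_to_deal n M \<in> barrucand_deals n \<longleftrightarrow>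
      (\<forall>x y. int (card (matrix_to_deal n M x)) = int (card (matrix_to_deal n M y)))"
    using matrix_to_deal_layout[OF M] by (simp add: barrucand_deals_eq)
  also have "\<dots> \<longleftrightarrow> count 1 1 = count 0 1 \<and> count 1 2 = count 0 2 \<and> count 1 3 = count 0 3"
    using total unfolding card_hand[OF M] count_def[symmetric] all_color player_number.simps
    by linarith
  also have "\<dots> \<longleftrightarrow> (\<forall>v. count 1 v = count 0 v)"
    using zero by (metis insertE singletonD)
  also have "\<dots> \<longleftrightarrow> M \<in> abelian_matrices n"
    using M unfolding count_def rearrangement_iff_counts[symmetric]
    by (simp add: abelian_matrices_def symbol_matrices_def)
  finally show ?thesis .
qed

theorem mainTheorem2:
  fixes n :: nat
  shows "(\<forall>H \<in> barrucand_deals n. \<forall>d \<in> {1..n}. \<exists>!c. column H d c) \<and>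
    bij_betw (deal_to_matrix n) (barrucand_deals n) (abelian_matrices n) \<and>
    (\<forall>M \<in> abelian_matrices n.
       inv_into (barrucand_deals n) (deal_to_matrix n) M = matrix_to_deal n M)"
proof (intro conjI ballI)
  have layout: "H \<in> layouts n" if "H \<in> barrucand_deals n" for H
    using that by (simp add: barrucand_deals_eq)
  have symbol: "M \<in> symbol_matrices n" if "M \<in> abelian_matrices n" for M
    using that by (simp add: abelian_matrices_def symbol_matrices_def)
  have deal: "matrix_to_deal n M \<in> barrucand_deals n" if "M \<in> abelian_matrices n" for M
    using that symbol matrix_to_deal_barrucand_iff by blast
  have abelian: "deal_to_matrix n H \<in> abelian_matrices n" if "H \<in> barrucand_deals n" for H
    using that layout matrix_to_deal_barrucand_iff[OF deal_to_matrix_symbols]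
      deal_to_matrix_to_deal by metis
  show "\<exists>!c. column H d c" if "H \<in> barrucand_deals n" for H d
    using column_unique_ex layout that by blast
  show bij: "bij_betw (deal_to_matrix n) (barrucand_deals n) (abelian_matrices n)"
    by (rule bij_betwI[where g = "matrix_to_deal n"])
       (use deal abelian layout symbol matrix_to_deal_to_matrix deal_to_matrix_to_deal in auto)
  show "inv_into (barrucand_deals n) (deal_to_matrix n) M = matrix_to_deal n M"
    if "M \<in> abelian_matrices n" for M
    using bij deal[OF that] matrix_to_deal_to_matrix[OF symbol[OF that]]
    by (intro inv_into_f_eq) (auto simp: bij_betw_def)
qed

end
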